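(* For each integer $n\ge 3$ we have \[ \mathcal{S}_n\cap\{\Re\le 0\}\subset D_{0.95}\cap\{\Re\le 0\}. \]
   Context: For a positive integer $n$ let $\mathcal{P}_n(z):=\sum_{k=0}^n \frac{(nz)^k}{k!}$ (with $0^0=1$) and $\mathcal{S}_n:=\{z\in\mathbb{C} : |\mathcal{P}_n(z)|\le 1\}$. For $\varrho>0$, $D_\varrho:=\{z\in\mathbb{C}: |z|\le\varrho\}$ is the closed disk of radius $\varrho$ centered at $0$, and $\{\Re\le 0\}:=\{z\in\mathbb{C}:\Re(z)\le 0\}$. *)

theory Defs
  imports "HOL-Analysis.Analysis"
begin

definition scaled_exp_poly :: "nat \<Rightarrow> complex \<Rightarrow> complex" where
  "scaled_exp_poly n z = (\<Sum>k=0..n. (of_nat n * z) ^ k / fact k)"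

definition sublevel_set :: "nat \<Rightarrow> complex set" where
  "sublevel_set n = {z. norm (scaled_exp_poly n z) \<le> 1}"

definition left_half_plane :: "complex set" where
  "left_half_plane = {z. Re z \<le> 0}"

end

theory Submission
  imports Defs
begin

text \<open>
  Put \<open>w = n z\<close>, so that \<open>P\<close>, the sum of \<open>w ^ k / k!\<close> over \<open>k \<le> n\<close>, is the value in question and
  the hypothesis becomes \<open>\<bar>w\<bar> > 0.95 n\<close> with \<open>Re w \<le> 0\<close>; the claim is \<open>\<bar>P\<bar> > 1\<close>.

  In the left half-plane \<open>\<bar>exp w\<bar> \<le> 1\<close>, so it is enough that the Taylor remainder \<open>exp w - P\<close> has
  modulus above \<open>2\<close>. For \<open>\<bar>w\<bar>\<close> comparable to \<open>n\<close> this remainder is close to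
  \<open>w ^ (n+1) / (n! (n + 1 - w))\<close>: the consecutive terms \<open>w ^ k / k!\<close> behind index \<open>n\<close> look like
  a geometric progression of ratio \<open>w / (n + 1)\<close>. The lemma \<open>norm_exp_tail_defect_le\<close> makes this
  precise: after multiplication by \<open>n + 1 - w\<close> the error is at most \<open>\<bar>w\<bar> ^ (n+2) / (n+2)!\<close>, hence
  smaller than the main term by a factor \<open>\<bar>w\<bar> / ((n+1) (n+2))\<close>. Since \<open>(0.95 n) ^ n / n!\<close> grows
  with \<open>n\<close> and exceeds \<open>8\<close> from \<open>n = 4\<close> on, the resulting lower bound beats \<open>2\<close> for all \<open>n \<ge> 4\<close> as
  long as \<open>\<bar>w\<bar> \<le> 3 n\<close>. For \<open>\<bar>w\<bar> > 3 n\<close> the top term of \<open>P\<close> outweighs all the others together.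

  For \<open>n = 3\<close> this lower bound stays below \<open>2\<close> when \<open>\<bar>w\<bar>\<close> is close to \<open>0.95 n\<close>, and
  \<open>\<bar>P\<bar>\<^sup>2 - 1\<close> is instead treated as an explicit polynomial in \<open>Re w\<close> and \<open>\<bar>w\<bar>\<^sup>2\<close>.
\<close>

section \<open>The Taylor remainder of the exponential in the left half-plane\<close>

definition exp_sum :: "nat \<Rightarrow> complex \<Rightarrow> complex" where
  "exp_sum n w = (\<Sum>k\<le>n. w ^ k / fact k)"

text \<open>
  The error made when the Taylor remainder of order \<open>n\<close> is replaced by
  \<open>w ^ (n+1) / (n! (n + 1 - w))\<close>, cleared of the denominator \<open>n + 1 - w\<close>.
\<close>
definition exp_tail_defect :: "nat \<Rightarrow> complex \<Rightarrow> complex" where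
  "exp_tail_defect n w = w ^ Suc n / fact n - (of_nat n + 1 - w) * (exp w - exp_sum n w)"

lemma exp_sum_Suc: "exp_sum (Suc n) w = exp_sum n w + w ^ Suc n / fact (Suc n)"
  by (simp add: exp_sum_def)

lemma exp_sum_at_0: "exp_sum n 0 = 1"
  by (induction n) (simp_all add: exp_sum_def)

lemma DERIV_power_over_fact:
  "((\<lambda>w::complex. w ^ Suc n / fact (Suc n)) has_field_derivative w ^ n / fact n) (at w)"
proof -
  have "((\<lambda>w::complex. w ^ Suc n / fact (Suc n)) has_field_derivative
           (of_nat (Suc n) * w ^ n) / fact (Suc n)) (at w)"
    using DERIV_cdivide[OF DERIV_power_Suc[OF DERIV_ident, of n w UNIV]]
    by (simp del: fact_Suc power_Suc)
  moreover have "(of_nat (Suc n) * w ^ n) / fact (Suc n) = w ^ n / fact n"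
    unfolding fact_Suc by (simp del: of_nat_Suc)
  ultimately show ?thesis by simp
qed

lemma DERIV_exp_sum: "(exp_sum (Suc n) has_field_derivative exp_sum n w) (at w)"
proof (induction n)
  case 0
  show ?case unfolding exp_sum_def by (auto intro!: derivative_eq_intros)
next
  case (Suc n)
  have "((\<lambda>w. exp_sum (Suc n) w + w ^ Suc (Suc n) / fact (Suc (Suc n))) has_field_derivative
          exp_sum n w + w ^ Suc n / fact (Suc n)) (at w)"
    by (intro DERIV_add Suc.IH DERIV_power_over_fact)
  then show ?case by (simp only: exp_sum_Suc[abs_def] exp_sum_Suc[of n])
qed

lemma DERIV_exp_tail_defect_0: "(exp_tail_defect 0 has_field_derivative w * exp w) (at w)"
  unfolding exp_tail_defect_def exp_sum_def
  by (auto intro!: derivative_eq_intros simp: algebra_simps)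

lemma DERIV_exp_tail_defect:
  "(exp_tail_defect (Suc n) has_field_derivative exp_tail_defect n w) (at w)"
proof -
  let ?m = "of_nat (Suc n) :: complex"
  have main: "((\<lambda>w. w ^ Suc (Suc n) / fact (Suc n)) has_field_derivative
          (?m + 1) * (w ^ Suc n / fact (Suc n))) (at w)"
    using DERIV_cdivide[OF DERIV_power_Suc[OF DERIV_ident, of "Suc n" w UNIV]]
    by (simp add: algebra_simps)
  have "(exp_tail_defect (Suc n) has_field_derivative
          (?m + 1) * (w ^ Suc n / fact (Suc n))
          - ((0 - 1) * (exp w - exp_sum (Suc n) w)
             + (exp w - exp_sum n w) * (?m + 1 - w))) (at w)"
    unfolding exp_tail_defect_def[abs_def]
    by (intro DERIV_diff DERIV_add main DERIV_mult DERIV_exp DERIV_exp_sum DERIV_const DERIV_ident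
        DERIV_cong[OF DERIV_diff[OF DERIV_const DERIV_ident]])
  moreover have "w ^ Suc n / fact n = ?m * (w ^ Suc n / fact (Suc n))"
    unfolding fact_Suc by (simp del: of_nat_Suc)
  then have "(?m + 1) * (w ^ Suc n / fact (Suc n))
          - ((0 - 1) * (exp w - exp_sum (Suc n) w) + (exp w - exp_sum n w) * (?m + 1 - w))
      = exp_tail_defect n w"
    unfolding exp_tail_defect_def exp_sum_Suc[of n]
    by (simp add: algebra_simps add_divide_distrib del: fact_Suc power_Suc)
  ultimately show ?thesis by simp
qed

text \<open>
  The left half-plane contains the segment from \<open>0\<close> to each of its points, so a bound on the
  derivative can be integrated along that segment.
\<close>
lemma norm_le_power_if_norm_deriv_le_power:
  fixes f f' :: "complex \<Rightarrow> complex"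
  assumes deriv: "\<And>w. (f has_field_derivative f' w) (at w)"
    and "f 0 = 0"
    and bound: "\<And>w. Re w \<le> 0 \<Longrightarrow> norm (f' w) \<le> norm w ^ m / fact m"
    and "Re w \<le> 0"
  shows "norm (f w) \<le> norm w ^ Suc m / fact (Suc m)"
proof -
  let ?\<phi> = "\<lambda>t::real. (t * norm w) ^ Suc m / fact (Suc m)"
  have "norm (f (of_real 1 * w) - f (of_real 0 * w)) \<le> ?\<phi> 1 - ?\<phi> 0"
  proof (rule differentiable_bound_general)
    show "continuous_on {0..1} (\<lambda>t. f (of_real t * w))"
      by (intro continuous_on_compose2[OF DERIV_continuous_on[of UNIV f f']] continuous_intros)
         (auto intro: deriv)
    show "((\<lambda>t. f (of_real t * w)) has_vector_derivative w * f' (of_real t * w)) (at t)"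
      for t :: real
    proof -
      have "((\<lambda>t. of_real t * w) has_vector_derivative w) (at t)"
        by (auto intro!: derivative_eq_intros simp: has_vector_derivative_def scaleR_conv_of_real)
      then have "(f \<circ> (\<lambda>t. of_real t * w) has_vector_derivative w * f' (of_real t * w)) (at t)"
        by (rule field_vector_diff_chain_at) (rule deriv)
      then show ?thesis by (simp add: o_def)
    qed
    show "(?\<phi> has_vector_derivative norm w * ((t * norm w) ^ m / fact m)) (at t)" for t :: real
    proof -
      have "(?\<phi> has_field_derivative (of_nat (Suc m) * (norm w * (t * norm w) ^ m)) / fact (Suc m))
              (at t)"
        using DERIV_cdivide[OF DERIV_power_Suc[OF DERIV_cmult_right[OF DERIV_ident]]]
        by (simp del: fact_Suc)
      moreover have "(of_nat (Suc m) * (norm w * (t * norm w) ^ m)) / fact (Suc m)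
          = norm w * ((t * norm w) ^ m / fact m)"
        unfolding fact_Suc by (simp del: of_nat_Suc)
      ultimately show ?thesis by (simp add: has_real_derivative_iff_has_vector_derivative)
    qed
    show "norm (w * f' (of_real t * w)) \<le> norm w * ((t * norm w) ^ m / fact m)"
      if "0 < t" "t < 1" for t :: real
    proof -
      have "Re (of_real t * w) \<le> 0"
        using that \<open>Re w \<le> 0\<close> by (simp add: mult_nonneg_nonpos)
      from bound[OF this] that show ?thesis
        unfolding norm_mult by (intro mult_left_mono) (simp_all add: norm_mult)
    qed
  qed (auto intro!: continuous_intros simp del: fact_Suc)
  then show ?thesis by (simp add: \<open>f 0 = 0\<close> del: fact_Suc)
qed

text \<open>
  Differentiating the defect lowers its index, and the chain ends at \<open>w * exp w\<close>, whose modulus is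
  at most \<open>\<bar>w\<bar>\<close> in the left half-plane; integrating back \<open>n + 1\<close> times gives the bound.
\<close>
lemma norm_exp_tail_defect_le:
  assumes "Re w \<le> 0"
  shows "norm (exp_tail_defect n w) \<le> norm w ^ (n + 2) / fact (n + 2)"
  using assms
proof (induction n arbitrary: w)
  case 0
  have "norm (exp_tail_defect 0 w) \<le> norm w ^ Suc 1 / fact (Suc 1)"
  proof (rule norm_le_power_if_norm_deriv_le_power[OF DERIV_exp_tail_defect_0 _ _ 0])
    show "norm (v * exp v) \<le> norm v ^ 1 / fact 1" if "Re v \<le> 0" for v
      using that by (simp add: norm_mult mult_left_le)
  qed (simp add: exp_tail_defect_def exp_sum_at_0)
  then show ?case by simp
next
  case (Suc n)
  have "norm (exp_tail_defect (Suc n) w) \<le> norm w ^ Suc (n + 2) / fact (Suc (n + 2))"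
    by (rule norm_le_power_if_norm_deriv_le_power[OF DERIV_exp_tail_defect _ Suc.IH Suc.prems])
       (simp_all add: exp_tail_defect_def exp_sum_at_0)
  then show ?case by simp
qed

text \<open>
  A small partial sum keeps the remainder below \<open>2\<close>, so the main term \<open>w ^ (n+1) / n!\<close> can
  exceed \<open>2 \<bar>n + 1 - w\<bar>\<close> only by the defect.
\<close>
lemma power_over_fact_le_if_exp_sum_le_1:
  assumes "Re w \<le> 0" and "norm (exp_sum n w) \<le> 1"
  defines "r \<equiv> norm w"
  shows "r ^ n / fact n * (r * (1 - r / ((real n + 1) * (real n + 2)))) \<le> 2 * (real n + 1 + r)"
proof -
  have "norm (exp w - exp_sum n w) \<le> norm (exp w) + norm (exp_sum n w)"
    by (rule norm_triangle_ineq4)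
  also have "\<dots> \<le> 1 + 1" by (intro add_mono) (use assms(1,2) in simp_all)
  finally have rem: "norm (exp w - exp_sum n w) \<le> 2" by simp
  have "norm (of_nat n + 1 - w) \<le> real n + 1 + r"
    using norm_triangle_ineq4[of "of_nat (Suc n)" w] unfolding r_def norm_of_nat
    by (simp add: add.commute)
  then have prod: "norm ((of_nat n + 1 - w) * (exp w - exp_sum n w)) \<le> (real n + 1 + r) * 2"
    unfolding norm_mult by (intro mult_mono rem) (auto simp: r_def)
  have "r ^ Suc n / fact n = norm (w ^ Suc n / fact n)"
    by (simp add: r_def norm_mult norm_divide norm_power)
  also have "w ^ Suc n / fact n
      = exp_tail_defect n w + (of_nat n + 1 - w) * (exp w - exp_sum n w)"
    by (simp add: exp_tail_defect_def)
  also have "norm \<dots> \<le> r ^ (n + 2) / fact (n + 2) + (real n + 1 + r) * 2"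
    using norm_exp_tail_defect_le[OF assms(1), of n] prod unfolding r_def
    by (intro norm_triangle_le add_mono)
  finally have "r ^ Suc n / fact n - r ^ (n + 2) / fact (n + 2) \<le> 2 * (real n + 1 + r)"
    by simp
  moreover have "r ^ (n + 2) / fact (n + 2)
      = r ^ n / fact n * (r * (r / ((real n + 1) * (real n + 2))))"
    by (simp add: fact_reduce field_simps power2_eq_square)
  ultimately show ?thesis by (simp add: algebra_simps)
qed

section \<open>Degree at least four\<close>

text \<open>The terms grow by a factor of at least \<open>3\<close> at each step up to index \<open>n\<close>.\<close>
lemma lower_terms_le_half_top_term:
  fixes r :: real
  assumes "3 * real n \<le> r"
  shows "2 * (\<Sum>k<n. r ^ k / fact k) \<le> r ^ n / fact n"
  using assms
proof (induction n)
  case 0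
  show ?case by simp
next
  case (Suc n)
  have "3 * (r ^ n / fact n) \<le> r / (real n + 1) * (r ^ n / fact n)"
    using Suc.prems by (intro mult_right_mono) (auto simp: field_simps)
  also have "\<dots> = r ^ Suc n / fact (Suc n)"
    by (simp add: field_simps)
  finally show ?case using Suc by (simp add: algebra_simps)
qed

lemma norm_exp_sum_ge_half_top_term:
  assumes "3 * real n \<le> norm w"
  shows "norm w ^ n / fact n \<le> 2 * norm (exp_sum n w)"
proof -
  have "exp_sum n w = w ^ n / fact n + (\<Sum>k<n. w ^ k / fact k)"
    by (simp add: exp_sum_def flip: lessThan_Suc_atMost)
  then have "norm (w ^ n / fact n) \<le> norm (exp_sum n w) + norm (\<Sum>k<n. w ^ k / fact k)"
    by (metis add_diff_cancel_right' norm_triangle_ineq4)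
  also have "norm (\<Sum>k<n. w ^ k / fact k) \<le> (\<Sum>k<n. norm w ^ k / fact k)"
    by (rule sum_norm_le) (simp add: norm_divide norm_power)
  finally have "norm w ^ n / fact n \<le> norm (exp_sum n w) + (\<Sum>k<n. norm w ^ k / fact k)"
    by (simp add: norm_divide norm_power)
  with lower_terms_le_half_top_term[OF assms] show ?thesis by linarith
qed

text \<open>
  Passing from \<open>n\<close> to \<open>n + 1\<close> multiplies the quotient by \<open>0.95 (1 + 1/n) ^ n\<close>, which is at least
  \<open>0.95 * 2\<close> by Bernoulli's inequality.
\<close>
lemma power_over_fact_ge_8:
  assumes "4 \<le> n"
  shows "8 \<le> (0.95 * real n) ^ n / fact n"
  using assms
proof (induction n rule: dec_induct)
  case base
  show ?case by (simp add: fact_numeral power4_eq_xxxx)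
next
  case (step n)
  have "2 \<le> (1 + 1 / real n) ^ n"
    using Bernoulli_inequality[of "1 / real n" n] step.hyps
    by (simp add: order_trans[of "- 1" 0])
  then have "1 \<le> 0.95 * (1 + 1 / real n) ^ n"
    by simp
  then have "(0.95 * real n) ^ n / fact n
      \<le> (0.95 * (1 + 1 / real n) ^ n) * ((0.95 * real n) ^ n / fact n)"
    using step.IH mult_right_mono[of 1 "0.95 * (1 + 1 / real n) ^ n" "(0.95 * real n) ^ n / fact n"]
    by simp
  also have "\<dots> = 0.95 * ((1 + 1 / real n) * (0.95 * real n)) ^ n / fact n"
    by (simp only: power_mult_distrib mult.assoc times_divide_eq_right)
  also have "(1 + 1 / real n) * (0.95 * real n) = 0.95 * real (Suc n)"
    using step.hyps by (simp add: field_simps)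
  also have "0.95 * (0.95 * real (Suc n)) ^ n / fact n = (0.95 * real (Suc n)) ^ Suc n / fact (Suc n)"
    unfolding fact_Suc power_Suc by (simp del: of_nat_Suc)
  finally show ?case using step.IH by simp
qed

lemma norm_exp_sum_gt_1_if_degree_ge_4:
  assumes "4 \<le> n" and "Re w \<le> 0" and large: "0.95 * real n < norm w"
  shows "1 < norm (exp_sum n w)"
proof (rule ccontr)
  assume "\<not> 1 < norm (exp_sum n w)"
  then have small: "norm (exp_sum n w) \<le> 1" by simp
  define r where "r = norm w"
  have "8 \<le> (0.95 * real n) ^ n / fact n"
    by (rule power_over_fact_ge_8) fact
  also have "\<dots> \<le> r ^ n / fact n"
    using large unfolding r_def by (intro divide_right_mono power_mono) auto
  finally have top: "8 \<le> r ^ n / fact n" .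
  have r3: "r < 3 * real n"
  proof (rule ccontr)
    assume "\<not> r < 3 * real n"
    then have "r ^ n / fact n \<le> 2 * norm (exp_sum n w)"
      unfolding r_def by (intro norm_exp_sum_ge_half_top_term) simp
    with top small show False by simp
  qed
  have "0 \<le> (real n - 4) * (4 * real n - 2)"
    using \<open>4 \<le> n\<close> by simp
  \<comment> \<open>The constant \<open>2/5\<close> is the value of \<open>3 n / ((n+1) (n+2))\<close> at \<open>n = 4\<close>, its maximum for \<open>n \<ge> 4\<close>.\<close>
  then have "r / ((real n + 1) * (real n + 2)) \<le> 2 / 5"
    using r3 by (subst pos_divide_le_eq) (simp, simp add: algebra_simps)
  then have "3 / 5 * r \<le> r * (1 - r / ((real n + 1) * (real n + 2)))"
    using mult_left_mono[of "3/5" "1 - r / ((real n + 1) * (real n + 2))" r]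
    by (simp add: r_def)
  with top have "8 * (3 / 5 * r) \<le> r ^ n / fact n * (r * (1 - r / ((real n + 1) * (real n + 2))))"
    by (rule mult_mono) (auto simp: r_def)
  also have "\<dots> \<le> 2 * (real n + 1 + r)"
    using power_over_fact_le_if_exp_sum_le_1[OF \<open>Re w \<le> 0\<close> small] unfolding r_def .
  finally show False
    using large \<open>4 \<le> n\<close> unfolding r_def by simp
qed

section \<open>Degree three\<close>

lemma norm_exp_sum_3_squared:
  "(norm (exp_sum 3 w))\<^sup>2 - 1 =
     ((norm w)\<^sup>2) ^ 3 / 36 - ((norm w)\<^sup>2)\<^sup>2 / 12
     + (2 + ((norm w)\<^sup>2)\<^sup>2 / 6) * Re w + (2 + 2 / 3 * (norm w)\<^sup>2) * (Re w)\<^sup>2 + 4 / 3 * Re w ^ 3"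
proof -
  obtain x y where w: "w = Complex x y" by (cases w)
  have "exp_sum 3 w = 1 + w + w\<^sup>2 / 2 + w ^ 3 / 6"
    by (simp add: exp_sum_def atMost_nat_numeral fact_numeral)
  then have "exp_sum 3 w = Complex (1 + x + (x\<^sup>2 - y\<^sup>2) / 2 + (x ^ 3 - 3 * x * y\<^sup>2) / 6)
      (y + x * y + (3 * x\<^sup>2 * y - y ^ 3) / 6)"
    by (simp add: w complex_eq_iff power2_eq_square power3_eq_cube algebra_simps)
  then have "(norm (exp_sum 3 w))\<^sup>2 = (1 + x + (x\<^sup>2 - y\<^sup>2) / 2 + (x ^ 3 - 3 * x * y\<^sup>2) / 6)\<^sup>2
      + (y + x * y + (3 * x\<^sup>2 * y - y ^ 3) / 6)\<^sup>2"
    by (simp add: cmod_power2)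
  moreover have "(norm w)\<^sup>2 = x\<^sup>2 + y\<^sup>2" "Re w = x"
    by (simp_all add: w cmod_power2)
  ultimately show ?thesis
    by (simp only:) (simp add: power2_eq_square power3_eq_cube field_simps)
qed

text \<open>
  Here \<open>a = - Re w\<close> and \<open>\<rho> = \<bar>w\<bar>\<^sup>2\<close>. The polynomial increases in \<open>\<rho>\<close> once \<open>\<rho> \<ge> 4\<close>, so only the
  smallest admissible \<open>\<rho>\<close> matters: \<open>2.85\<^sup>2\<close> if \<open>a \<le> 2.85\<close>, and otherwise \<open>a\<^sup>2\<close>, that is, \<open>w\<close> real.
\<close>
lemma degree_3_polynomial_pos:
  fixes a \<rho> :: real
  assumes "0 \<le> a" and "a\<^sup>2 \<le> \<rho>" and "2.85\<^sup>2 \<le> \<rho>"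
  shows "0 < \<rho> ^ 3 / 36 - \<rho>\<^sup>2 / 12 - (2 + \<rho>\<^sup>2 / 6) * a + (2 + 2 / 3 * \<rho>) * a\<^sup>2 - 4 / 3 * a ^ 3"
proof -
  define F where "F = (\<lambda>\<rho>::real. \<rho> ^ 3 / 36 - \<rho>\<^sup>2 / 12 - (2 + \<rho>\<^sup>2 / 6) * a
      + (2 + 2 / 3 * \<rho>) * a\<^sup>2 - 4 / 3 * a ^ 3)"
  have mono: "F s \<le> F t" if "4 \<le> s" "s \<le> t" for s t
  proof -
    \<comment> \<open>The difference quotient of \<open>F\<close>, with the square in \<open>a\<close> completed.\<close>
    have "F t - F s = (t - s) * (2 / 3 * (a - (s + t) / 8)\<^sup>2
        + ((t - s)\<^sup>2 / 144 + ((s + t) * (s + t - 8)) / 96))"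
      unfolding F_def by (simp add: field_simps power2_eq_square power3_eq_cube)
    also have "\<dots> \<ge> 0"
      using that by (intro mult_nonneg_nonneg add_nonneg_nonneg) auto
    finally show ?thesis by simp
  qed
  have "0 < F \<rho>"
  proof (cases "a \<le> 2.85")
    case True
    \<comment> \<open>In \<open>a\<close> this is a cubic. The double zero of the first summand is chosen to match the
      coefficient of \<open>a\<^sup>2\<close>, so that the rest is linear; it is positive at both ends of \<open>[0, 2.85]\<close>.\<close>
    have "F (2.85\<^sup>2) = (2.85 - a) * (4 / 3 * (a - 1.355625)\<^sup>2)
        + (2.40436086328125 - 0.2427921875 * a)"
      unfolding F_def by (simp add: power2_eq_square power3_eq_cube field_simps)
    also have "0 < \<dots>"
      using True by (intro add_nonneg_pos mult_nonneg_nonneg) auto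
    finally have "0 < F (2.85\<^sup>2)" .
    also have "\<dots> \<le> F \<rho>" by (rule mono) (use assms(3) in \<open>simp_all add: power2_eq_square\<close>)
    finally show ?thesis .
  next
    case False
    have sq: "2.85\<^sup>2 \<le> a\<^sup>2" using False by (intro power_mono) auto
    \<comment> \<open>At \<open>\<rho> = a\<^sup>2\<close> the polynomial is \<open>p\<^sup>2 - 1\<close>, where \<open>p\<close> is the partial sum at \<open>- a\<close>.\<close>
    have F_real: "F (a\<^sup>2) = (1 - a + a\<^sup>2 / 2 - a ^ 3 / 6)\<^sup>2 - 1"
      unfolding F_def by (simp add: field_simps power2_eq_square power3_eq_cube)
    \<comment> \<open>The cubic, divided by \<open>a - 2.85\<close>: both the remainder and the quotient, with its square
      completed, are positive.\<close>
    have "- (1 - a + a\<^sup>2 / 2 - a ^ 3 / 6)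
        = 1 + ((a - 2.85) * ((a - 0.075)\<^sup>2 / 6 + 0.9278125) + 0.6469375)"
      by (simp add: power2_eq_square power3_eq_cube field_simps)
    also have "1 < \<dots>"
      using False by (intro less_add_same_cancel1[THEN iffD2] add_nonneg_pos mult_nonneg_nonneg
          add_nonneg_nonneg) auto
    finally have "1 < - (1 - a + a\<^sup>2 / 2 - a ^ 3 / 6)" .
    then have "1 < (- (1 - a + a\<^sup>2 / 2 - a ^ 3 / 6))\<^sup>2"
      by (simp only: one_less_power)
    then have "0 < F (a\<^sup>2)" by (simp only: F_real power2_minus)
    also have "\<dots> \<le> F \<rho>" by (rule mono) (use sq assms(2) in \<open>simp_all add: power2_eq_square\<close>)
    finally show ?thesis .
  qed
  then show ?thesis by (simp add: F_def)
qed

lemma norm_exp_sum_3_gt_1: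
  assumes "Re w \<le> 0" and "2.85 < norm w"
  shows "1 < norm (exp_sum 3 w)"
proof -
  have "(- Re w)\<^sup>2 \<le> (norm w)\<^sup>2"
    by (simp add: cmod_power2)
  moreover have "2.85\<^sup>2 \<le> (norm w)\<^sup>2"
    using assms(2) by (intro power_mono) auto
  ultimately have "0 < (norm (exp_sum 3 w))\<^sup>2 - 1"
    using degree_3_polynomial_pos[of "- Re w" "(norm w)\<^sup>2"] assms(1)
    unfolding norm_exp_sum_3_squared by simp
  then show ?thesis
    using power2_less_imp_less[of 1 "norm (exp_sum 3 w)"] by simp
qed

theorem theorem3p4:
  fixes n :: nat
  assumes "n \<ge> 3"
  shows "sublevel_set n \<inter> left_half_plane \<subseteq> cball 0 0.95 \<inter> left_half_plane"
proof
  fix z assume z: "z \<in> sublevel_set n \<inter> left_half_plane"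
  define w where "w = of_nat n * z"
  have "scaled_exp_poly n z = exp_sum n w"
    by (simp add: scaled_exp_poly_def exp_sum_def w_def atLeast0AtMost)
  with z have small: "norm (exp_sum n w) \<le> 1"
    by (simp add: sublevel_set_def)
  have left: "Re w \<le> 0"
    using z by (simp add: w_def left_half_plane_def mult_nonneg_nonpos)
  have norm_w: "norm w = real n * norm z"
    by (simp add: w_def norm_mult)
  have "norm z \<le> 0.95"
  proof (rule ccontr)
    assume "\<not> norm z \<le> 0.95"
    then have large: "0.95 * real n < norm w"
      using assms by (simp add: norm_w)
    have "1 < norm (exp_sum n w)"
    proof (cases "n = 3")
      case True
      with left large show ?thesis using norm_exp_sum_3_gt_1[of w] by simp
    next
      case False
      with assms left large show ?thesis by (intro norm_exp_sum_gt_1_if_degree_ge_4) auto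
    qed
    with small show False by simp
  qed
  with z show "z \<in> cball 0 0.95 \<inter> left_half_plane" by simp
qed

end
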